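(* Let $F:\mathbb D\subset\mathbb X\to\mathbb Y$ be a continuously Fréchet differentiable nonlinear operator, $\mathbb D$ open and convex. Assume that there is an initial point $x_0\in\mathbb D$ such that $F'(x_0)^{-1}$ exists and that $F'$ satisfies the $L$-average Lipschitz condition on $\mathbf B(x_0,t^* )$. Let $\{x_k\}$ be the sequence generated by the two-step Newton method with initial point $x_0$. If $0<\beta\le b$, then $\{x_k\}$ is well-defined and converges Q-superquadratically to a solution $x^*\in\overline{\mathbf B(x_0,t^* )}$ of $F(x)=0$, and this solution $x^*$ is unique in $\overline{\mathbf B(x_0,r)}$, where $t^*\le r<t^{**}$. Moreover, if $$2+\frac{t^*h''(t^* )}{h'(t^* )}>0\iff 2-\frac{t^*L(t^* )}{1-\int_0^{t^*}L(u)\,du}>0,$$ then the order of convergence is at least cubic (Q-cubic) and, with $H_*:=h''(t^* )/h'(t^* )$, $$\|x^*-x_{k+1}\|\le\frac12H_*^2\cdot\frac{2-t^*H_*}{2+t^*H_*}\cdot\|x^*-x_k\|^3,\qquad k\ge0.$$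
   Context: $\mathbb X,\mathbb Y$ are Banach spaces; $\mathbf B(x,r)$ is the open ball with center $x$ and radius $r$, and $\overline{\mathbf B(x,r)}$ its closure. $L(\cdot)$ is a positive nondecreasing function on $[0,R)$, where $R>0$ satisfies $\frac1R\int_0^RL(u)(R-u)\,du=1$. The number $r_0$ satisfies $\int_0^{r_0}L(u)\,du=1$, and $b:=\int_0^{r_0}L(u)u\,du$. The point $x_0\in\mathbb D$ is such that $F'(x_0)^{-1}$ exists and $\mathbf B(x_0,r_0)\subset\mathbb D$; set $\beta:=\|F'(x_0)^{-1}F(x_0)\|$. The majorizing function is $h(t)=\beta-t+\int_0^tL(u)(t-u)\,du$, $t\in[0,R]$; so $h'(t)=-1+\int_0^tL(u)\,du$, and $h''(t)$ stands for $L(t)$. The numbers $t^*$ and $t^{**}$ are the unique zeros of $h$ in $[0,r_0]$ and $[r_0,R]$, respectively (for $0<\beta\le b$). $L$-average Lipschitz condition: $F'$ satisfies it on $\mathbf B(x_0,r)\subseteq\mathbb D$ if for all $x,y\in\mathbf B(x_0,r)$ with $\|x-x_0\|+\|y-x\|<r$, $$\|F'(x_0)^{-1}[F'(y)-F'(x)]\|\le\int_{\|x-x_0\|}^{\|x-x_0\|+\|y-x\|}L(u)\,du.$$ Two-step Newton method: $y_k=x_k-F'(x_k)^{-1}F(x_k)$, $x_{k+1}=y_k-F'(x_k)^{-1}F(y_k)$, $k=0,1,2,\dots$. $\{x_k\}$ converges to $x^*$ Q-superquadratically if for any $c>0$ there is $N_c\ge0$ with $\|x_{k+1}-x^*\|\le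 c\|x_k-x^*\|^2$ for all $k\ge N_c$; it converges Q-cubically if there are constants $c\ge0$, $N_c\ge0$ with $\|x_{k+1}-x^*\|\le c\|x_k-x^*\|^3$ for all $k\ge N_c$.
   Formalization: Q-superquadratic convergence and x* in D are claimed only for β<b (for β=b: convergence, and F(x* )=0 if x* is in D); the cubic part assumes h'(t* )≠0; uniqueness in the closed ball of radius r is for zeros in D and assumes the L-average Lipschitz condition on B(x_0,r). *)

theory Defs
  imports "HOL-Analysis.Analysis"
begin

definition blinfun_invertible :: "('a::real_normed_vector \<Rightarrow>\<^sub>L 'b::real_normed_vector) \<Rightarrow> bool" where
  "blinfun_invertible A \<longleftrightarrow> (\<exists>B. B o\<^sub>L A = id_blinfun \<and> A o\<^sub>L B = id_blinfun)"

definition blinfun_inv :: "('a::real_normed_vector \<Rightarrow>\<^sub>L 'b::real_normed_vector) \<Rightarrow> ('b \<Rightarrow>\<^sub>L 'a)" where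
  "blinfun_inv A = (THE B. B o\<^sub>L A = id_blinfun \<and> A o\<^sub>L B = id_blinfun)"

text \<open>Only the values of \<open>L\<close> on \<open>[0,R)\<close> matter: the integrand in \<open>majorant\<close>
  vanishes at \<open>u = t\<close>, so \<open>majorant \<beta> L R\<close> does not depend on the value \<open>L R\<close>.\<close>

definition majorant :: "real \<Rightarrow> (real \<Rightarrow> real) \<Rightarrow> real \<Rightarrow> real" where
  "majorant \<beta> L t = \<beta> - t + integral {0..t} (\<lambda>u. L u * (t - u))"

text \<open>The derivative of the majorant, which does not depend on \<open>\<beta>\<close>. Its second derivative
  is by convention \<open>L\<close> itself, also at points where \<open>L\<close> is not continuous.\<close>

definition majorant' :: "(real \<Rightarrow> real) \<Rightarrow> real \<Rightarrow> real" where
  "majorant' L t = - 1 + integral {0..t} L"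

definition average_lipschitz ::
  "'a set \<Rightarrow> ('a::real_normed_vector \<Rightarrow> ('a \<Rightarrow>\<^sub>L 'b::real_normed_vector)) \<Rightarrow> (real \<Rightarrow> real) \<Rightarrow> 'a \<Rightarrow> real \<Rightarrow> bool"
where
  "average_lipschitz D F' L x0 r \<longleftrightarrow>
     ball x0 r \<subseteq> D \<and>
     (\<forall>x\<in>ball x0 r. \<forall>y\<in>ball x0 r. norm (x - x0) + norm (y - x) < r \<longrightarrow>
        norm (blinfun_inv (F' x0) o\<^sub>L (F' y - F' x))
          \<le> integral {norm (x - x0) .. norm (x - x0) + norm (y - x)} L)"

definition newton_step ::
  "('a::real_normed_vector \<Rightarrow> 'b::real_normed_vector) \<Rightarrow> ('a \<Rightarrow> ('a \<Rightarrow>\<^sub>L 'b)) \<Rightarrow> 'a \<Rightarrow> 'a"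
where
  "newton_step F F' x = x - blinfun_inv (F' x) (F x)"

text \<open>This recursion is total; that the iteration really makes sense (all points lie in the
  domain and all the inverses exist) is \<open>two_step_newton_well_defined\<close>.\<close>

primrec two_step_newton ::
  "('a::real_normed_vector \<Rightarrow> 'b::real_normed_vector) \<Rightarrow> ('a \<Rightarrow> ('a \<Rightarrow>\<^sub>L 'b)) \<Rightarrow> 'a \<Rightarrow> nat \<Rightarrow> 'a"
where
  "two_step_newton F F' x0 0 = x0"
| "two_step_newton F F' x0 (Suc k) =
     (let x = two_step_newton F F' x0 k; y = newton_step F F' x
      in y - blinfun_inv (F' x) (F y))"

definition two_step_newton_well_defined ::
  "'a set \<Rightarrow> ('a::real_normed_vector \<Rightarrow> 'b::real_normed_vector) \<Rightarrow> ('a \<Rightarrow> ('a \<Rightarrow>\<^sub>L 'b)) \<Rightarrow> 'a \<Rightarrow> bool"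
where
  "two_step_newton_well_defined D F F' x0 \<longleftrightarrow>
     (\<forall>k. two_step_newton F F' x0 k \<in> D
        \<and> blinfun_invertible (F' (two_step_newton F F' x0 k))
        \<and> newton_step F F' (two_step_newton F F' x0 k) \<in> D)"

definition q_superquadratic :: "(nat \<Rightarrow> 'a::real_normed_vector) \<Rightarrow> 'a \<Rightarrow> bool" where
  "q_superquadratic x xs \<longleftrightarrow> x \<longlonglongrightarrow> xs \<and>
     (\<forall>c>0. \<exists>N. \<forall>k\<ge>N. norm (x (Suc k) - xs) \<le> c * norm (x k - xs) ^ 2)"

definition q_cubic :: "(nat \<Rightarrow> 'a::real_normed_vector) \<Rightarrow> 'a \<Rightarrow> bool" where
  "q_cubic x xs \<longleftrightarrow> x \<longlonglongrightarrow> xs \<and>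
     (\<exists>c\<ge>0. \<exists>N. \<forall>k\<ge>N. norm (x (Suc k) - xs) \<le> c * norm (x k - xs) ^ 3)"

end

theory Submission
  imports Defs
begin

text \<open>
  Write \<open>\<Gamma> = F'(x\<^sub>0)\<^sup>-\<^sup>1\<close>. The scalar two-step Newton iteration \<open>t\<^sub>k\<close> for the convex function \<open>h\<close>
  increases and stays below \<open>t\<^sup>*\<close>, and it dominates the iteration in the Banach space: the bounds
  \<open>\<parallel>x\<^sub>k - x\<^sub>0\<parallel> \<le> t\<^sub>k\<close> and \<open>\<parallel>\<Gamma> F(x\<^sub>k)\<parallel> \<le> h(t\<^sub>k)\<close> propagate, because the remainders of \<open>F\<close> are
  bounded by those of \<open>h\<close> and \<open>\<parallel>F'(x\<^sub>k)\<^sup>-\<^sup>1 w\<parallel> \<le> \<parallel>\<Gamma> w\<parallel> / \<bar>h'(t\<^sub>k)\<bar>\<close>.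

  The error bounds do not need the scalar errors. If \<open>t\<^sup>* < r\<^sub>0\<close>, then \<open>\<Gamma> F'\<close> is Lipschitz with
  constant \<open>L(t\<^sup>*)\<close> between \<open>x\<^sub>k\<close> and the points of the segments to \<open>x\<^sup>*\<close>, so that with
  \<open>M = \<bar>H\<^sub>*\<bar>\<close> and \<open>e = \<parallel>x\<^sup>* - x\<^sub>k\<parallel>\<close> one gets \<open>\<parallel>x\<^sup>* - y\<^sub>k\<parallel> \<le> M e\<^sup>2 / 2\<close> and
  \<open>\<parallel>x\<^sup>* - x\<^sub>k\<^sub>+\<^sub>1\<parallel> \<le> (M\<^sup>2 / 2) (1 + M e / 4) e\<^sup>3\<close>. Since \<open>e \<le> t\<^sup>*\<close>, the factor \<open>1 + M e / 4\<close> is at most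
  \<open>(2 + t\<^sup>* M) / (2 - t\<^sup>* M)\<close> whenever \<open>t\<^sup>* M < 2\<close>.

  For uniqueness, a zero \<open>z\<close> satisfies \<open>h(\<parallel>z - x\<^sub>0\<parallel>) \<ge> 0\<close>, which excludes distances in
  \<open>(t\<^sup>*, t\<^sup>*\<^sup>*)\<close>, and \<open>\<Gamma> F - id\<close> is a contraction on the closed ball of radius \<open>t\<^sup>*\<close>.
\<close>

subsection \<open>The scalar majorant\<close>

locale lipschitz_weight =
  fixes L :: "real \<Rightarrow> real" and R :: real
  assumes L_pos: "\<And>u. u \<in> {0..<R} \<Longrightarrow> L u > 0"
    and L_mono: "mono_on {0..<R} L"
begin

lemma L_le: "L s \<le> L t" if "0 \<le> s" "s \<le> t" "t < R"
  using L_mono that by (auto simp: mono_on_def)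

lemma L_nonneg: "0 \<le> L t" if "0 \<le> t" "t < R"
  using L_pos[of t] that by simp

lemma L_integrable: "L integrable_on {s..t}" if "0 \<le> s" "t < R"
  by (rule integrable_on_mono_on, rule mono_on_subset[OF L_mono]) (use that in auto)

lemma ident_L_integrable: "(\<lambda>u. u * L u) integrable_on {s..t}" if "0 \<le> s" "t < R"
proof (rule integrable_on_mono_on, rule mono_onI)
  fix u v assume "u \<in> {s..t}" "v \<in> {s..t}" "u \<le> v"
  then show "u * L u \<le> v * L v"
    using that by (intro mult_mono L_le L_nonneg) auto
qed

lemma integral_L_le: "integral {s..t} L \<le> L t * (t - s)" if "0 \<le> s" "s \<le> t" "t < R"
proof -
  have "integral {s..t} L \<le> integral {s..t} (\<lambda>_. L t)"
    by (rule integral_le) (use that in \<open>auto intro!: L_integrable L_le\<close>)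
  then show ?thesis using that by (simp add: mult.commute)
qed

lemma integral_L_ge: "L s * (t - s) \<le> integral {s..t} L" if "0 \<le> s" "s \<le> t" "t < R"
proof -
  have "integral {s..t} (\<lambda>_. L s) \<le> integral {s..t} L"
    by (rule integral_le) (use that in \<open>auto intro!: L_integrable L_le\<close>)
  then show ?thesis using that by (simp add: mult.commute)
qed

lemma majorant'_diff: "majorant' L t - majorant' L s = integral {s..t} L"
  if "0 \<le> s" "s \<le> t" "t < R"
  using Henstock_Kurzweil_Integration.integral_combine[where a=0 and c=s and b=t and f=L] L_integrable[of 0 t] that by (simp add: majorant'_def)

lemma majorant'_strict_mono: "majorant' L s < majorant' L t" if "0 \<le> s" "s < t" "t < R"
proof -
  have "0 < L s * (t - s)" using that by (intro mult_pos_pos L_pos) auto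
  then show ?thesis
    using integral_L_ge[of s t] majorant'_diff[of s t] that by linarith
qed

lemma majorant'_mono: "majorant' L s \<le> majorant' L t" if "0 \<le> s" "s \<le> t" "t < R"
  using majorant'_strict_mono[of s t] that by (cases "s = t") auto

lemma majorant'_diff_le: "majorant' L t - majorant' L s \<le> L t * (t - s)"
  if "0 \<le> s" "s \<le> t" "t < R"
  using integral_L_le[OF that] majorant'_diff[OF that] by simp

text \<open>Shifting an interval to the right raises the nondecreasing \<open>L\<close> pointwise,
  and lengthening it adds a nonnegative amount. Distances in the Lipschitz condition can thereby be
  replaced by upper bounds.\<close>

lemma majorant'_diff_mono:
  "majorant' L (a + d) - majorant' L a \<le> majorant' L (a' + d') - majorant' L a'"
  if "0 \<le> a" "a \<le> a'" "0 \<le> d" "d \<le> d'" "a' + d' < R"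
proof -
  have "integral {a..a+d} L \<le> integral {a..a+d} (\<lambda>u. L (u + (a' - a)))"
  proof (rule integral_le)
    show "(\<lambda>u. L (u + (a' - a))) integrable_on {a..a+d}"
      by (rule integrable_on_mono_on, rule mono_onI, rule L_le) (use that in auto)
  qed (use that in \<open>auto intro!: L_integrable L_le\<close>)
  also have "\<dots> = integral {a'..a'+d} L"
  proof -
    have "((\<lambda>u. L u) has_integral integral {a'..a'+d} L) {a'..a'+d}"
      using that by (intro integrable_integral L_integrable) auto
    from has_integral_affinity'[of L _ a' "a'+d" 1 "a'-a"] this
    have "((\<lambda>u. L (u + (a' - a))) has_integral integral {a'..a'+d} L) {a..a+d}"
      by (simp add: algebra_simps)
    then show ?thesis by (rule integral_unique)
  qed
  finally have "majorant' L (a + d) - majorant' L a \<le> majorant' L (a' + d) - majorant' L a'"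
    using that by (subst (1 2) majorant'_diff) auto
  also have "\<dots> \<le> majorant' L (a' + d') - majorant' L a'"
    using that by (intro diff_right_mono majorant'_mono) auto
  finally show ?thesis .
qed

lemma majorant'_continuous: "continuous_on {0..<R} (majorant' L)"
  unfolding continuous_on_eq_continuous_within
proof
  fix t assume t: "t \<in> {0..<R}"
  \<comment> \<open>Nothing bounds \<open>L\<close> near \<open>R\<close>, so continuity of the
    indefinite integral is used on a compact interval \<open>{0..c}\<close> and transferred, since
    both sets agree near \<open>t\<close>.\<close>
  define c where "c = (t + R) / 2"
  have c: "t < c" "c < R" using t by (auto simp: c_def)
  have "continuous_on {0..c} (majorant' L)"
    unfolding majorant'_def
    using c by (intro continuous_intros indefinite_integral_continuous_1 L_integrable) auto
  then have "continuous (at t within {0..c}) (majorant' L)"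
    using t c by (auto simp: continuous_on_eq_continuous_within)
  moreover have "at t within {0..c} = at t within {0..<R}"
    by (rule at_within_nhd[of _ "{..<c}"]) (use c in auto)
  ultimately show "continuous (at t within {0..<R}) (majorant' L)" by simp
qed

lemma majorant_eq:
  "majorant \<beta> L t = \<beta> - t + t * integral {0..t} L - integral {0..t} (\<lambda>u. u * L u)" if "t < R"
proof -
  have "integral {0..t} (\<lambda>u. L u * (t - u)) = integral {0..t} (\<lambda>u. t * L u - u * L u)"
    by (simp add: algebra_simps)
  also have "\<dots> = t * integral {0..t} L - integral {0..t} (\<lambda>u. u * L u)"
    using that L_integrable[of 0 t] ident_L_integrable[of 0 t]
    by (subst integral_diff) (auto intro: integrable_on_mult_right)
  finally show ?thesis by (simp add: majorant_def)
qed

text \<open>This is convexity of \<open>h\<close>: the two gaps are the integrals of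
  \<open>(t - u) * L u\<close> and \<open>(u - s) * L u\<close> over \<open>{s..t}\<close>. No
  second derivative is used, so jumps of \<open>L\<close> do no harm.\<close>

lemma majorant_slope:
  assumes "0 \<le> s" "s \<le> t" "t < R"
  shows "majorant' L s * (t - s) \<le> majorant \<beta> L t - majorant \<beta> L s"
    and "majorant \<beta> L t - majorant \<beta> L s \<le> majorant' L t * (t - s)"
proof -
  define I where "I = (\<lambda>t. integral {0..t} L)"
  define K where "K = (\<lambda>t. integral {0..t} (\<lambda>u. u * L u))"
  have I: "integral {s..t} L = I t - I s"
    using Henstock_Kurzweil_Integration.integral_combine[where a=0 and c=s and b=t and f=L] L_integrable[of 0 t] assms by (simp add: I_def)
  have K: "integral {s..t} (\<lambda>u. u * L u) = K t - K s"
    using Henstock_Kurzweil_Integration.integral_combine[where a=0 and c=s and b=t and f="\<lambda>u. u * L u"] ident_L_integrable[of 0 t] assms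
    by (simp add: K_def)
  have "integral {s..t} (\<lambda>u. s * L u) \<le> integral {s..t} (\<lambda>u. u * L u)"
    using assms by (intro integral_le integrable_on_mult_right L_integrable ident_L_integrable
        mult_right_mono L_nonneg) auto
  then have lo: "s * (I t - I s) \<le> K t - K s" by (simp add: I K)
  have "integral {s..t} (\<lambda>u. u * L u) \<le> integral {s..t} (\<lambda>u. t * L u)"
    using assms by (intro integral_le integrable_on_mult_right L_integrable ident_L_integrable
        mult_right_mono L_nonneg) auto
  then have hi: "K t - K s \<le> t * (I t - I s)" by (simp add: I K)
  have h: "majorant \<beta> L t = \<beta> - t + t * I t - K t" "majorant \<beta> L s = \<beta> - s + s * I s - K s"
    using assms by (simp_all add: majorant_eq I_def K_def)
  have h': "majorant' L t = I t - 1" "majorant' L s = I s - 1"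
    by (simp_all add: majorant'_def I_def)
  show "majorant' L s * (t - s) \<le> majorant \<beta> L t - majorant \<beta> L s"
    using hi by (simp add: h h' algebra_simps)
  show "majorant \<beta> L t - majorant \<beta> L s \<le> majorant' L t * (t - s)"
    using lo by (simp add: h h' algebra_simps)
qed

lemma majorant_slope_strict:
  assumes "0 \<le> s" "s < t" "t < R"
  shows "majorant' L s * (t - s) < majorant \<beta> L t - majorant \<beta> L s"
    and "majorant \<beta> L t - majorant \<beta> L s < majorant' L t * (t - s)"
proof -
  \<comment> \<open>The midpoint makes the bounds strict: each half satisfies the weak slope bound,
    and passing from the slope at \<open>m\<close> to the one at an endpoint is strict.\<close>
  define m where "m = (s + t) / 2"
  have m: "s < m" "m < t" using assms by (auto simp: m_def)
  have "majorant' L s * (t - m) < majorant' L m * (t - m)"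
    "majorant' L m * (m - s) < majorant' L t * (m - s)"
    using m assms majorant'_strict_mono[of s m] majorant'_strict_mono[of m t] by simp_all
  moreover have "majorant' L m * (t - m) \<le> majorant \<beta> L t - majorant \<beta> L m"
    "majorant' L s * (m - s) \<le> majorant \<beta> L m - majorant \<beta> L s"
    "majorant \<beta> L t - majorant \<beta> L m \<le> majorant' L t * (t - m)"
    "majorant \<beta> L m - majorant \<beta> L s \<le> majorant' L m * (m - s)"
    using m assms by (auto intro!: majorant_slope)
  moreover have "x * (t - s) = x * (t - m) + x * (m - s)" for x
    by (simp add: algebra_simps)
  note this[of "majorant' L s"] this[of "majorant' L t"]
  ultimately show "majorant' L s * (t - s) < majorant \<beta> L t - majorant \<beta> L s"
    and "majorant \<beta> L t - majorant \<beta> L s < majorant' L t * (t - s)"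
    by linarith+
qed

text \<open>By \<open>majorant_slope\<close> the difference quotient lies between the values of
  \<open>majorant' L\<close> at the two points, and these merge by continuity.\<close>

lemma majorant_has_derivative:
  assumes t: "t \<in> {0..<R}"
  shows "(majorant \<beta> L has_real_derivative majorant' L t) (at t within {0..<R})"
proof -
  have est: "\<bar>(majorant \<beta> L s - majorant \<beta> L t) / (s - t) - majorant' L t\<bar>
      \<le> \<bar>majorant' L s - majorant' L t\<bar>" if s: "s \<in> {0..<R}" "s \<noteq> t" for s
  proof (cases "s < t")
    case True
    then have "majorant' L s \<le> (majorant \<beta> L s - majorant \<beta> L t) / (s - t)"
        "(majorant \<beta> L s - majorant \<beta> L t) / (s - t) \<le> majorant' L t"
      using majorant_slope[of s t \<beta>] s t by (auto simp: field_simps)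
    then show ?thesis by linarith
  next
    case False
    then have "majorant' L t \<le> (majorant \<beta> L s - majorant \<beta> L t) / (s - t)"
        "(majorant \<beta> L s - majorant \<beta> L t) / (s - t) \<le> majorant' L s"
      using majorant_slope[of t s \<beta>] s t by (auto simp: field_simps)
    then show ?thesis by linarith
  qed
  have "((\<lambda>s. majorant' L s - majorant' L t) \<longlongrightarrow> 0) (at t within {0..<R})"
    using majorant'_continuous t
    by (auto simp: continuous_on_def LIM_zero_iff)
  then have "((\<lambda>s. (majorant \<beta> L s - majorant \<beta> L t) / (s - t) - majorant' L t) \<longlongrightarrow> 0)
      (at t within {0..<R})"
    by (rule Lim_null_comparison[rotated, OF tendsto_rabs_zero])
       (use est in \<open>auto simp: eventually_at intro!: exI[of _ 1]\<close>)
  then show ?thesis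
    by (simp add: has_field_derivative_iff LIM_zero_iff)
qed

text \<open>The estimates for \<open>L\<close> require points strictly below \<open>R\<close>. If
  \<open>r0 = R\<close>, subtracting the normalization of \<open>R\<close> from \<open>R\<close>
  times the equation for \<open>r0\<close> makes the integral of \<open>u * L u\<close> vanish,
  against positivity.\<close>

lemma radius_less:
  assumes "R > 0" "integral {0..R} (\<lambda>u. L u * (R - u)) = R"
    and r0: "r0 \<in> {0..R}" "integral {0..r0} L = 1"
  shows "r0 < R"
proof (rule ccontr)
  assume "\<not> r0 < R"
  then have "r0 = R" using r0 by simp
  \<comment> \<open>A non-integrable function has integral 0 by convention, whereas these integrals
    are 1 and \<open>R\<close>.\<close>
  have "L integrable_on {0..R}" "(\<lambda>u. L u * (R - u)) integrable_on {0..R}"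
    using assms \<open>r0 = R\<close> not_integrable_integral by force+
  then have "((\<lambda>u. R * L u - L u * (R - u)) has_integral R * 1 - R) {0..R}"
    using assms \<open>r0 = R\<close>
    by (intro has_integral_diff has_integral_mult_right) (auto simp: has_integral_iff)
  \<comment> \<open>The value \<open>L R\<close> is arbitrary; \<open>g\<close> replaces it by
    \<open>L 0\<close>, so that \<open>L 0 * u \<le> g u\<close> holds on the whole closed
    interval.\<close>
  moreover define g where "g u = (if u = R then L 0 else L u) * u" for u
  ultimately have "(g has_integral 0) {0..R}"
    by (intro has_integral_spike_finite[of "{R}" _ g]) (auto simp: g_def algebra_simps)
  moreover have "((\<lambda>u. L 0 * u) has_integral L 0 * ((R\<^sup>2 - 0\<^sup>2) / 2)) {0..R}"
    using \<open>R > 0\<close> by (intro has_integral_mult_right ident_has_integral) simp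
  ultimately have "L 0 * ((R\<^sup>2 - 0\<^sup>2) / 2) \<le> 0"
    by (elim has_integral_le[rotated]) (use L_le[of 0] in \<open>auto simp: g_def intro!: mult_right_mono\<close>)
  moreover have "0 < L 0 * (R\<^sup>2 / 2)" using L_pos[of 0] \<open>R > 0\<close> by simp
  ultimately show False by simp
qed

end

subsection \<open>Inverses of bounded linear operators\<close>

lemma blinfun_inv_eqI: "blinfun_inv A = B" if "B o\<^sub>L A = id_blinfun" "A o\<^sub>L B = id_blinfun"
  unfolding blinfun_inv_def
proof (rule the_equality)
  fix C assume "C o\<^sub>L A = id_blinfun \<and> A o\<^sub>L C = id_blinfun"
  then have "C v = (B o\<^sub>L A) (C v)" "(A o\<^sub>L C) v = v" for v using that by simp_all
  then show "C = B" by (auto intro!: blinfun_eqI)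
qed (use that in auto)

lemma
  assumes "blinfun_invertible A"
  shows blinfun_inv_left: "blinfun_inv A (A v) = v"
    and blinfun_inv_right: "A (blinfun_inv A w) = w"
proof -
  obtain B where B: "B o\<^sub>L A = id_blinfun" "A o\<^sub>L B = id_blinfun"
    using assms by (auto simp: blinfun_invertible_def)
  then have "blinfun_inv A = B" by (rule blinfun_inv_eqI)
  with B show "blinfun_inv A (A v) = v" "A (blinfun_inv A w) = w"
    by (metis blinfun_apply_blinfun_compose blinfun_apply_id_blinfun)+
qed

text \<open>The Banach perturbation lemma: \<open>blinfun_inv A0\<close> composed with
  \<open>A\<close> is the identity plus an operator of norm at most \<open>q < 1\<close>. Keeping
  \<open>norm (blinfun_inv A0 w)\<close> unsplit lets later estimates see \<open>F\<close> only
  through \<open>\<Gamma>\<close>.\<close>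

lemma blinfun_inv_perturbation:
  fixes A A0 :: "'a::banach \<Rightarrow>\<^sub>L 'b::real_normed_vector"
  assumes A0: "blinfun_invertible A0"
    and q: "norm (blinfun_inv A0 o\<^sub>L (A - A0)) \<le> q" "q < 1"
  shows "blinfun_invertible A"
    and "norm (blinfun_inv A w) \<le> norm (blinfun_inv A0 w) / (1 - q)"
proof -
  let ?G = "blinfun_inv A0" and ?E = "blinfun_inv A0 o\<^sub>L (A - A0)"
  have E: "?G (A v) = v + ?E v" for v
    by (simp add: blinfun.diff_left blinfun.diff_right blinfun_inv_left[OF A0])
  have q0: "0 \<le> q" using q norm_ge_zero order_trans by blast
  have Eq: "norm (?E v) \<le> q * norm v" for v
    by (rule order_trans[OF norm_blinfun mult_right_mono[OF q(1)]]) simp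
  \<comment> \<open>This lower bound yields injectivity and, once surjectivity is known, the norm
    estimate for the inverse.\<close>
  have below: "(1 - q) * norm v \<le> norm (?G (A v))" for v
  proof -
    have "norm v - norm (?E v) \<le> norm (v + ?E v)"
      using norm_diff_ineq by blast
    with Eq[of v] show ?thesis by (simp add: E algebra_simps)
  qed
  have "\<exists>v. A v = w" for w
  proof -
    \<comment> \<open>The equation \<open>A v = w\<close> becomes a fixed point equation for a
      contraction on the complete domain.\<close>
    have "\<exists>!v. ?G w - ?E v = v"
    proof (rule banach_fix_type[OF q0 q(2)], intro allI)
      fix x y
      have "dist (?G w - ?E x) (?G w - ?E y) = norm (?E (y - x))"
        by (simp only: dist_norm blinfun.diff_right) (simp add: algebra_simps)
      with Eq[of "y - x"] show "dist (?G w - ?E x) (?G w - ?E y) \<le> q * dist x y"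
        by (simp add: dist_norm norm_minus_commute)
    qed
    then obtain v where "?G w - ?E v = v" by auto
    then have "?G (A v) = ?G w" unfolding E by (metis diff_add_cancel)
    then show ?thesis by (metis A0 blinfun_inv_right)
  qed
  then have surj: "surj A" by (metis surjI)
  have inj: "inj A"
  proof (rule injI)
    fix u v assume "A u = A v"
    then have "?G (A (u - v)) = 0" by (simp add: blinfun.diff_right)
    with below[of "u - v"] q show "u = v" by (simp add: mult_le_0_iff)
  qed
  define B where "B = inv A"
  have AB: "A (B w) = w" for w using surj by (simp add: B_def surj_f_inv_f)
  have BA: "B (A v) = v" for v using inj by (simp add: B_def)
  have Bnorm: "norm (B w) \<le> norm (?G w) / (1 - q)" for w
    using below[of "B w"] q by (simp add: AB field_simps)
  have lin: "bounded_linear B"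
  proof (rule bounded_linear_intro)
    fix w z r
    show "B (w + z) = B w + B z" by (metis AB BA blinfun.add_right)
    show "B (r *\<^sub>R w) = r *\<^sub>R B w" by (metis AB BA blinfun.scaleR_right)
    have "norm (?G w) / (1 - q) \<le> norm ?G * norm w / (1 - q)"
      using q by (intro divide_right_mono norm_blinfun) auto
    with Bnorm[of w] show "norm (B w) \<le> norm w * (norm ?G / (1 - q))"
      by (simp add: mult.commute)
  qed
  have "Blinfun B o\<^sub>L A = id_blinfun" "A o\<^sub>L Blinfun B = id_blinfun"
    by (auto intro!: blinfun_eqI simp: bounded_linear_Blinfun_apply[OF lin] AB BA)
  then show "blinfun_invertible A" "norm (blinfun_inv A w) \<le> norm (blinfun_inv A0 w) / (1 - q)"
    using Bnorm[of w] blinfun_inv_eqI[of "Blinfun B" A]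
    by (auto simp: blinfun_invertible_def bounded_linear_Blinfun_apply[OF lin])
qed

section \<open>Mean value estimates along segments\<close>

text \<open>The mean value inequality on the segment from \<open>p\<close> to \<open>q\<close>. The
  free operator \<open>A\<close> allows a derivative frozen at a third point. The bound concerns
  interior \<open>\<tau>\<close> only, because an endpoint may lie on the boundary of the ball of
  the Lipschitz condition.\<close>

lemma blinfun_remainder_bound:
  fixes F :: "'a::real_normed_vector \<Rightarrow> 'b::real_normed_vector"
    and G :: "'b \<Rightarrow>\<^sub>L 'c::real_normed_vector"
  assumes deriv: "\<And>\<tau>. \<tau> \<in> {0..1} \<Longrightarrow>
      (F has_derivative blinfun_apply (F' (p + \<tau> *\<^sub>R (q - p)))) (at (p + \<tau> *\<^sub>R (q - p)))"
    and \<phi>: "\<And>\<tau>. \<tau> \<in> {0..1} \<Longrightarrow> (\<phi> has_real_derivative \<phi>' \<tau>) (at \<tau> within {0..1})"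
    and bound: "\<And>\<tau>. \<tau> \<in> {0<..<1} \<Longrightarrow>
      norm (G o\<^sub>L (F' (p + \<tau> *\<^sub>R (q - p)) - A)) * norm (q - p) \<le> \<phi>' \<tau>"
  shows "norm (G (F q - F p - A (q - p))) \<le> \<phi> 1 - \<phi> 0"
proof -
  define f where "f \<tau> = G (F (p + \<tau> *\<^sub>R (q - p)) - \<tau> *\<^sub>R A (q - p))" for \<tau>
  define f' where "f' \<tau> = (G o\<^sub>L (F' (p + \<tau> *\<^sub>R (q - p)) - A)) (q - p)" for \<tau>
  have f: "(f has_vector_derivative f' \<tau>) (at \<tau>)" if "\<tau> \<in> {0..1}" for \<tau>
  proof -
    have "((\<lambda>\<tau>. F (p + \<tau> *\<^sub>R (q - p))) has_derivative
        (\<lambda>d. F' (p + \<tau> *\<^sub>R (q - p)) (d *\<^sub>R (q - p)))) (at \<tau>)"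
      by (rule has_derivative_compose[where g = F and f = "\<lambda>\<tau>. p + \<tau> *\<^sub>R (q - p)", OF _ deriv[OF that]])
        (auto intro!: derivative_eq_intros)
    then show ?thesis
      unfolding f_def has_vector_derivative_def
      by (auto intro!: derivative_eq_intros bounded_linear.has_derivative[OF blinfun.bounded_linear_right] simp: f'_def blinfun.bilinear_simps algebra_simps)
  qed
  have "norm (f 1 - f 0) \<le> \<phi> 1 - \<phi> 0"
  proof (rule differentiable_bound_general)
    show "continuous_on {0..1} f"
      using f by (intro continuous_at_imp_continuous_on ballI) (rule has_vector_derivative_continuous)
    show "continuous_on {0..1} \<phi>"
      using \<phi> by (rule DERIV_continuous_on)
    show "(\<phi> has_vector_derivative \<phi>' \<tau>) (at \<tau>)" if "0 < \<tau>" "\<tau> < 1" for \<tau>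
      using \<phi>[of \<tau>] that
      by (simp add: has_real_derivative_iff_has_vector_derivative at_within_Icc_at)
    show "norm (f' \<tau>) \<le> \<phi>' \<tau>" if "0 < \<tau>" "\<tau> < 1" for \<tau>
      using order_trans[OF norm_blinfun bound[of \<tau>]] that by (simp add: f'_def)
  qed (use f in auto)
  then show ?thesis by (simp add: f_def blinfun.bilinear_simps algebra_simps)
qed

lemma segment_dist:
  "norm (p + \<tau> *\<^sub>R (q - p) - x) \<le> (1 - \<tau>) * norm (p - x) + \<tau> * norm (q - x)"
  if "\<tau> \<in> {0..1}" for p q x :: "'a::real_normed_vector"
proof -
  have "p + \<tau> *\<^sub>R (q - p) - x = (1 - \<tau>) *\<^sub>R (p - x) + \<tau> *\<^sub>R (q - x)"
    by (simp add: algebra_simps)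
  also have "norm \<dots> \<le> norm ((1 - \<tau>) *\<^sub>R (p - x)) + norm (\<tau> *\<^sub>R (q - x))"
    by (rule norm_triangle_ineq)
  finally show ?thesis using that by simp
qed

subsection \<open>The two-step Newton iteration\<close>

locale majorized_newton = lipschitz_weight L R for L R +
  fixes D :: "'a::banach set" and F :: "'a \<Rightarrow> 'b::banach" and F' :: "'a \<Rightarrow> ('a \<Rightarrow>\<^sub>L 'b)"
    and x0 :: 'a and \<beta> \<rho> :: real
  assumes open_D: "open D" and convex_D: "convex D"
    and F_deriv: "\<And>x. x \<in> D \<Longrightarrow> (F has_derivative blinfun_apply (F' x)) (at x)"
    and F'_cont: "continuous_on D F'"
    and inv_x0: "blinfun_invertible (F' x0)"
    and \<beta>_def: "\<beta> = norm (blinfun_inv (F' x0) (F x0))"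
    and \<rho>: "0 < \<rho>" "\<rho> < R" "majorant' L \<rho> \<le> 0" "majorant \<beta> L \<rho> = 0"
    and lip: "average_lipschitz D F' L x0 \<rho>"
begin

abbreviation "h \<equiv> majorant \<beta> L"
abbreviation "h' \<equiv> majorant' L"
abbreviation "\<Gamma> \<equiv> blinfun_inv (F' x0)"

section \<open>Scalar Newton steps\<close>

definition half_step :: "real \<Rightarrow> real" where
  "half_step t = t - h t / h' t"

definition full_step :: "real \<Rightarrow> real" where
  "full_step t = half_step t - h (half_step t) / h' t"

definition corrector :: "'a \<Rightarrow> 'a" where
  "corrector x = newton_step F F' x - blinfun_inv (F' x) (F (newton_step F F' x))"

lemma ball_subset: "ball x0 \<rho> \<subseteq> D"
  using lip by (simp add: average_lipschitz_def)

lemma h'_0: "h' 0 = -1"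
  by (simp add: majorant'_def)

lemma h_0: "h 0 = \<beta>"
  by (simp add: majorant_def)

lemma h'_neg: "h' t < 0" if "0 \<le> t" "t < \<rho>"
  using majorant'_strict_mono[of t \<rho>] that \<rho> by linarith

lemma h_pos: "0 < h t" if "0 \<le> t" "t < \<rho>"
proof -
  have "h \<rho> - h t < h' \<rho> * (\<rho> - t)" using that \<rho> by (intro majorant_slope_strict)
  also have "\<dots> \<le> 0" using that \<rho> by (intro mult_nonpos_nonneg) auto
  finally show ?thesis using \<rho> by simp
qed

lemma half_step_eq: "h t + h' t * (half_step t - t) = 0" if "0 \<le> t" "t < \<rho>"
  using h'_neg[OF that] by (simp add: half_step_def)

lemma full_step_eq: "h (half_step t) + h' t * (full_step t - half_step t) = 0"
  if "0 \<le> t" "t < \<rho>"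
  using h'_neg[OF that] by (simp add: full_step_def)

text \<open>By strict convexity the tangent at \<open>t\<close> lies below \<open>h\<close> to the
  right of \<open>t\<close>, so its zero comes before the zero \<open>\<rho>\<close> of
  \<open>h\<close>.\<close>

lemma half_step_bounds: "t < half_step t" "half_step t < \<rho>" if t: "0 \<le> t" "t < \<rho>"
proof -
  show "t < half_step t"
    using h'_neg[OF t] h_pos[OF t] by (simp add: half_step_def divide_pos_neg)
  have "h' t * (\<rho> - t) < h \<rho> - h t" using t \<rho> by (intro majorant_slope_strict)
  then have "h' t * (\<rho> - t) < h' t * (half_step t - t)"
    using half_step_eq[OF t] \<rho> by linarith
  then show "half_step t < \<rho>" using h'_neg[OF t] by simp
qed

text \<open>The line used here starts on the graph at \<open>half_step t\<close> with slope
  \<open>h' t\<close>. It descends more steeply than the tangent there, so it too reaches zero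
  before \<open>\<rho>\<close>.\<close>

lemma full_step_bounds: "half_step t < full_step t" "full_step t < \<rho>" if t: "0 \<le> t" "t < \<rho>"
proof -
  let ?s = "half_step t"
  have s: "0 \<le> ?s" "t < ?s" "?s < \<rho>" using half_step_bounds[OF t] t by auto
  show "?s < full_step t"
    using h'_neg[OF t] h_pos[of ?s] s by (simp add: full_step_def divide_pos_neg)
  have "h' t * (\<rho> - ?s) < h' ?s * (\<rho> - ?s)"
    using majorant'_strict_mono[of t ?s] s t \<rho> by simp
  moreover have "h' ?s * (\<rho> - ?s) < h \<rho> - h ?s" using s \<rho> by (intro majorant_slope_strict)
  ultimately have "h' t * (\<rho> - ?s) < h' t * (full_step t - ?s)"
    using full_step_eq[OF t] \<rho> by linarith
  then show "full_step t < \<rho>" using h'_neg[OF t] by simp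
qed

section \<open>Transfer of the scalar bounds to the operator\<close>

text \<open>The radius \<open>r\<close> is free because the condition is used on the ball of radius
  \<open>\<rho>\<close> and, for uniqueness, on possibly larger ones.\<close>

lemma average_lipschitz_majorant':
  assumes lip: "average_lipschitz D F' L x0 r" "r \<le> R"
    and "norm (x - x0) \<le> a" "norm (w - x) \<le> d" "a + d < r"
  shows "norm (\<Gamma> o\<^sub>L (F' w - F' x)) \<le> h' (a + d) - h' a"
proof -
  have "norm (w - x0) \<le> norm (w - x) + norm (x - x0)"
    using norm_triangle_ineq[of "w - x" "x - x0"] by simp
  then have w: "w \<in> ball x0 r" using assms by (simp add: dist_norm norm_minus_commute)
  have x: "x \<in> ball x0 r" using assms norm_ge_zero[of "w - x"]
    by (simp add: dist_norm norm_minus_commute del: norm_ge_zero)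
  have "norm (\<Gamma> o\<^sub>L (F' w - F' x))
      \<le> integral {norm (x - x0)..norm (x - x0) + norm (w - x)} L"
    using lip(1) w x assms unfolding average_lipschitz_def by auto
  also have "\<dots> = h' (norm (x - x0) + norm (w - x)) - h' (norm (x - x0))"
    using assms by (subst majorant'_diff) auto
  also have "\<dots> \<le> h' (a + d) - h' a"
    using assms by (intro majorant'_diff_mono) auto
  finally show ?thesis .
qed

lemma inverse_bound:
  assumes "norm (x - x0) \<le> t" "t < \<rho>"
  shows "blinfun_invertible (F' x)"
    and "norm (blinfun_inv (F' x) w) \<le> norm (\<Gamma> w) / - h' t"
proof -
  have t: "0 \<le> t" using assms(1) norm_ge_zero order_trans by blast
  have "norm (\<Gamma> o\<^sub>L (F' x - F' x0)) \<le> h' (0 + t) - h' 0"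
    using assms \<rho> by (intro average_lipschitz_majorant'[OF lip]) auto
  then have *: "norm (\<Gamma> o\<^sub>L (F' x - F' x0)) \<le> 1 + h' t" by (simp add: h'_0)
  \<comment> \<open>The perturbation lemma is applied with \<open>q = 1 + h' t\<close>, so that
    \<open>1 - q\<close> is \<open>- h' t\<close>.\<close>
  have "1 + h' t < 1" using h'_neg t assms by simp
  from blinfun_inv_perturbation[OF inv_x0 * this]
  show "blinfun_invertible (F' x)" "norm (blinfun_inv (F' x) w) \<le> norm (\<Gamma> w) / - h' t"
    by simp_all
qed

lemma h_affine_derivative:
  assumes "0 \<le> s" "s \<le> u" "u < R" "\<tau> \<in> {0..1}"
  shows "((\<lambda>\<tau>. h (s + \<tau> * (u - s)) - c * \<tau>) has_real_derivative
    (u - s) * h' (s + \<tau> * (u - s)) - c) (at \<tau> within {0..1})"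
proof -
  have ran: "s + \<tau>' * (u - s) \<in> {0..<R}" if "\<tau>' \<in> {0..1}" for \<tau>'
  proof -
    have "\<tau>' * (u - s) \<le> 1 * (u - s)" using that assms by (intro mult_right_mono) auto
    then show ?thesis using that assms by auto
  qed
  \<comment> \<open>At 0 the derivative of \<open>h\<close> is one-sided, hence the chain rule
    within the image of \<open>{0..1}\<close>.\<close>
  have "(h has_real_derivative h' (s + \<tau> * (u - s)))
      (at (s + \<tau> * (u - s)) within (\<lambda>\<tau>. s + \<tau> * (u - s)) ` {0..1})"
    by (rule DERIV_subset[OF majorant_has_derivative]) (use ran assms in auto)
  moreover have "((\<lambda>\<tau>. s + \<tau> * (u - s)) has_real_derivative u - s) (at \<tau> within {0..1})"
    by (auto intro!: derivative_eq_intros)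
  ultimately have "(h \<circ> (\<lambda>\<tau>. s + \<tau> * (u - s)) has_real_derivative
      h' (s + \<tau> * (u - s)) * (u - s)) (at \<tau> within {0..1})"
    by (rule DERIV_image_chain)
  then have "((\<lambda>\<tau>. h (s + \<tau> * (u - s))) has_real_derivative
      h' (s + \<tau> * (u - s)) * (u - s)) (at \<tau> within {0..1})" by (simp add: o_def)
  then show ?thesis by (auto intro!: derivative_eq_intros simp: mult.commute)
qed

lemma segment_in_D: "p + \<tau> *\<^sub>R (q - p) \<in> D" if "p \<in> D" "q \<in> D" "\<tau> \<in> {0..1}"
proof -
  have "(1 - \<tau>) *\<^sub>R p + \<tau> *\<^sub>R q \<in> D" using that convex_D by (intro convexD) auto
  then show ?thesis by (simp add: algebra_simps)
qed

lemma in_ball: "w \<in> ball x0 \<rho>" if "norm (x - x0) \<le> a" "norm (w - x) \<le> d" "a + d < \<rho>"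
proof -
  have "norm (w - x0) \<le> norm (w - x) + norm (x - x0)"
    using norm_triangle_ineq[of "w - x" "x - x0"] by simp
  then show ?thesis using that by (simp add: dist_norm norm_minus_commute)
qed

text \<open>The scalars \<open>t\<close>, \<open>s\<close>, \<open>u\<close> stand for
  \<open>x\<close>, \<open>p\<close>, \<open>q\<close>, and the right side is the same remainder for
  \<open>h\<close>. The derivative stays at \<open>x\<close>: taking \<open>p = x\<close> serves the
  Newton step, taking the Newton point for \<open>p\<close> serves the corrector.\<close>

lemma majorized_remainder:
  assumes x: "norm (x - x0) \<le> t" and p: "norm (p - x) \<le> s - t" and q: "norm (q - p) \<le> u - s"
    and u: "u < \<rho>"
  shows "norm (\<Gamma> (F q - F p - F' x (q - p))) \<le> h u - h s - h' t * (u - s)"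
proof -
  have st: "0 \<le> t" "t \<le> s" "s \<le> u"
    using x p q norm_ge_zero[of "x - x0"] norm_ge_zero[of "p - x"] norm_ge_zero[of "q - p"]
    by linarith+
  have qx: "norm (q - x) \<le> u - t"
    using norm_triangle_ineq[of "q - p" "p - x"] p q by simp
  have pq: "p \<in> D" "q \<in> D" using in_ball[OF x p] in_ball[OF x qx] st u ball_subset by auto
  define \<phi> where "\<phi> = (\<lambda>\<tau>. h (s + \<tau> * (u - s)) - (u - s) * h' t * \<tau>)"
  have "norm (\<Gamma> (F q - F p - F' x (q - p))) \<le> \<phi> 1 - \<phi> 0"
  proof (rule blinfun_remainder_bound)
    show "(F has_derivative blinfun_apply (F' (p + \<tau> *\<^sub>R (q - p)))) (at (p + \<tau> *\<^sub>R (q - p)))"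
      if "\<tau> \<in> {0..1}" for \<tau>
      using that pq by (intro F_deriv segment_in_D)
    show "(\<phi> has_real_derivative (u - s) * h' (s + \<tau> * (u - s)) - (u - s) * h' t)
        (at \<tau> within {0..1})" if "\<tau> \<in> {0..1}" for \<tau>
      unfolding \<phi>_def using that st u \<rho> by (intro h_affine_derivative) auto
    fix \<tau> :: real assume \<tau>: "\<tau> \<in> {0<..<1}"
    have "\<tau> * norm (q - p) \<le> \<tau> * (u - s)" using \<tau> q by simp
    moreover have "norm (p - x + \<tau> *\<^sub>R (q - p)) \<le> norm (p - x) + \<tau> * norm (q - p)"
      using norm_triangle_ineq[of "p - x" "\<tau> *\<^sub>R (q - p)"] \<tau> by simp
    ultimately have "norm (p + \<tau> *\<^sub>R (q - p) - x) \<le> (s - t) + \<tau> * (u - s)"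
      using p unfolding diff_add_eq by linarith
    moreover have "\<tau> * (u - s) \<le> 1 * (u - s)" using \<tau> st by (intro mult_right_mono) auto
    ultimately have "norm (\<Gamma> o\<^sub>L (F' (p + \<tau> *\<^sub>R (q - p)) - F' x))
        \<le> h' (t + ((s - t) + \<tau> * (u - s))) - h' t"
      using x u \<rho> by (intro average_lipschitz_majorant'[OF lip]) auto
    then have *: "norm (\<Gamma> o\<^sub>L (F' (p + \<tau> *\<^sub>R (q - p)) - F' x))
        \<le> h' (s + \<tau> * (u - s)) - h' t" by simp
    then have "norm (\<Gamma> o\<^sub>L (F' (p + \<tau> *\<^sub>R (q - p)) - F' x)) * norm (q - p)
        \<le> (h' (s + \<tau> * (u - s)) - h' t) * (u - s)"
      using q by (rule mult_mono) (use order_trans[OF norm_ge_zero *] in simp_all)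
    then show "norm (\<Gamma> o\<^sub>L (F' (p + \<tau> *\<^sub>R (q - p)) - F' x)) * norm (q - p)
        \<le> (u - s) * h' (s + \<tau> * (u - s)) - (u - s) * h' t"
      by (simp add: algebra_simps)
  qed
  then show ?thesis by (simp add: \<phi>_def algebra_simps)
qed

text \<open>Each substep solves a linear equation, so the residual at the new point equals a
  remainder; the scalar remainder equals \<open>h\<close> at the new scalar point for the same
  reason. \<open>inverse_bound\<close> turns residuals into step lengths.\<close>

lemma newton_majorized:
  assumes x: "norm (x - x0) \<le> t" "norm (\<Gamma> (F x)) \<le> h t" and t: "t < \<rho>"
  shows "norm (newton_step F F' x - x) \<le> half_step t - t"
    and "norm (corrector x - newton_step F F' x) \<le> full_step t - half_step t"
    and "norm (\<Gamma> (F (corrector x))) \<le> h (full_step t)"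
proof -
  let ?s = "half_step t" and ?u = "full_step t"
  define y z where "y = newton_step F F' x" and "z = corrector x"
  have t0: "0 \<le> t" using x(1) norm_ge_zero order_trans by blast
  note neg = h'_neg[OF t0 t] and inv = inverse_bound[OF x(1) t]
  have Ay: "F x + F' x (y - x) = 0"
    by (simp add: y_def newton_step_def blinfun.minus_right blinfun_inv_right[OF inv(1)])
  have Az: "F y + F' x (z - y) = 0"
    by (simp add: y_def z_def corrector_def blinfun.minus_right blinfun_inv_right[OF inv(1)])
  have "norm (y - x) = norm (blinfun_inv (F' x) (F x))" by (simp add: y_def newton_step_def)
  also have "\<dots> \<le> norm (\<Gamma> (F x)) / - h' t" by (rule inv)
  also have "\<dots> \<le> h t / - h' t" using x neg by (intro divide_right_mono) auto
  finally have yx: "norm (y - x) \<le> ?s - t" by (simp add: half_step_def)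
  have "norm (\<Gamma> (F y - F x - F' x (y - x))) \<le> h ?s - h t - h' t * (?s - t)"
    using x yx half_step_bounds[OF t0 t] by (intro majorized_remainder) auto
  moreover have "F y - F x - F' x (y - x) = F y" using Ay by (simp add: algebra_simps)
  ultimately have Fy: "norm (\<Gamma> (F y)) \<le> h ?s" using half_step_eq[OF t0 t] by simp
  have "norm (z - y) = norm (blinfun_inv (F' x) (F y))" by (simp add: y_def z_def corrector_def)
  also have "\<dots> \<le> norm (\<Gamma> (F y)) / - h' t" by (rule inv)
  also have "\<dots> \<le> h ?s / - h' t" using Fy neg by (intro divide_right_mono) auto
  finally have zy: "norm (z - y) \<le> ?u - ?s" by (simp add: full_step_def)
  have "norm (\<Gamma> (F z - F y - F' x (z - y))) \<le> h ?u - h ?s - h' t * (?u - ?s)"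
    using x yx zy full_step_bounds[OF t0 t] by (intro majorized_remainder)
  moreover have "F z - F y - F' x (z - y) = F z" using Az by (simp add: algebra_simps)
  ultimately have "norm (\<Gamma> (F z)) \<le> h ?u" using full_step_eq[OF t0 t] by simp
  with yx zy show "norm (newton_step F F' x - x) \<le> ?s - t"
    "norm (corrector x - newton_step F F' x) \<le> ?u - ?s" "norm (\<Gamma> (F (corrector x))) \<le> h ?u"
    by (simp_all add: y_def z_def)
qed

section \<open>The iterates and their limit\<close>

primrec tseq :: "nat \<Rightarrow> real" where
  "tseq 0 = 0"
| "tseq (Suc k) = full_step (tseq k)"

abbreviation "X \<equiv> two_step_newton F F' x0"

lemma X_Suc: "X (Suc k) = corrector (X k)"
  by (simp add: corrector_def Let_def)

lemma tseq_bounds: "0 \<le> tseq k \<and> tseq k < \<rho>"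
proof (induction k)
  case (Suc k)
  then have "0 \<le> half_step (tseq k)" "half_step (tseq k) < full_step (tseq k)"
    using half_step_bounds[of "tseq k"] full_step_bounds[of "tseq k"] by auto
  then show ?case using Suc full_step_bounds[of "tseq k"] by auto
qed (use \<rho> in simp)

lemma tseq_incr: "tseq k < half_step (tseq k)" "half_step (tseq k) < tseq (Suc k)"
  using half_step_bounds[of "tseq k"] full_step_bounds[of "tseq k"] tseq_bounds[of k] by auto

lemma X_majorized: "norm (X k - x0) \<le> tseq k \<and> norm (\<Gamma> (F (X k))) \<le> h (tseq k)"
proof (induction k)
  case 0
  then show ?case by (simp add: h_0) (simp add: \<beta>_def)
next
  case (Suc k)
  note step = newton_majorized[of "X k" "tseq k"]
  have "norm (X (Suc k) - X k) \<le> tseq (Suc k) - tseq k"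
    using norm_triangle_ineq[of "corrector (X k) - newton_step F F' (X k)"
        "newton_step F F' (X k) - X k"] step Suc tseq_bounds[of k]
    unfolding X_Suc by simp
  then have "norm (X (Suc k) - x0) \<le> tseq (Suc k)"
    using norm_triangle_ineq[of "X (Suc k) - X k" "X k - x0"] Suc by simp
  then show ?case using step Suc tseq_bounds[of k] unfolding X_Suc by simp
qed

lemma newton_step_le: "norm (newton_step F F' (X k) - X k) \<le> half_step (tseq k) - tseq k"
  using newton_majorized(1)[of "X k" "tseq k"] X_majorized[of k] tseq_bounds[of k] by blast

lemma X_increment: "norm (X (Suc k) - X k) \<le> tseq (Suc k) - tseq k"
  using norm_triangle_ineq[of "corrector (X k) - newton_step F F' (X k)"
      "newton_step F F' (X k) - X k"] newton_majorized(2)[of "X k" "tseq k"]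
    newton_step_le[of k] X_majorized[of k] tseq_bounds[of k]
  unfolding X_Suc by simp

lemma X_in_ball: "X k \<in> ball x0 \<rho>"
  using X_majorized[of k] tseq_bounds[of k] by (auto simp: dist_norm norm_minus_commute)

lemma X_in_D: "X k \<in> D"
  using X_in_ball ball_subset by blast

lemma newton_step_in_D: "newton_step F F' (X k) \<in> D"
  using in_ball[OF conjunct1[OF X_majorized[of k]] newton_step_le[of k]]
    half_step_bounds[of "tseq k"] tseq_bounds[of k] ball_subset by auto

lemma X_invertible: "blinfun_invertible (F' (X k))"
  using inverse_bound(1) X_majorized tseq_bounds by blast

lemma well_defined: "two_step_newton_well_defined D F F' x0"
  unfolding two_step_newton_well_defined_def
  using X_in_D X_invertible newton_step_in_D by blast

lemma X_diff_le: "norm (X (k + n) - X k) \<le> tseq (k + n) - tseq k"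
proof (induction n)
  case (Suc n)
  then show ?case
    using norm_triangle_ineq[of "X (Suc (k + n)) - X (k + n)" "X (k + n) - X k"]
      X_increment[of "k + n"] by (simp del: two_step_newton.simps tseq.simps)
qed simp

lemma tseq_mono: "incseq tseq"
  using tseq_incr by (intro incseq_SucI) (meson less_trans less_imp_le)

lemma tseq_convergent: "convergent tseq"
proof (rule Bseq_mono_convergent)
  show "Bseq tseq"
    using tseq_bounds by (intro BseqI'[of _ \<rho>]) (auto intro: less_imp_le)
qed (use incseqD[OF tseq_mono] in blast)

lemma X_convergent: "convergent X"
proof (rule Cauchy_convergent, rule metric_CauchyI)
  fix e :: real assume "0 < e"
  then obtain N where N: "\<And>m n. m \<ge> N \<Longrightarrow> n \<ge> N \<Longrightarrow> dist (tseq m) (tseq n) < e"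
    using convergent_Cauchy[OF tseq_convergent] by (metis metric_CauchyD)
  have *: "dist (X m) (X n) < e" if "N \<le> n" "n \<le> m" for m n
  proof -
    have "dist (X m) (X n) \<le> tseq m - tseq n"
      using X_diff_le[of n "m - n"] that by (simp add: dist_norm)
    also have "\<dots> < e" using N[of m n] that by (auto simp: dist_real_def)
    finally show ?thesis .
  qed
  show "\<exists>M. \<forall>m\<ge>M. \<forall>n\<ge>M. dist (X m) (X n) < e"
  proof (intro exI[of _ N] allI impI)
    fix m n assume "N \<le> m" "N \<le> n"
    then show "dist (X m) (X n) < e"
      using *[of n m] *[of m n] by (cases "n \<le> m") (auto simp: dist_commute)
  qed
qed

definition xs :: 'a where "xs = lim X"

lemma X_lim: "X \<longlonglongrightarrow> xs"
  using X_convergent by (simp add: xs_def convergent_LIMSEQ_iff)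

lemma xs_dist: "norm (xs - X k) \<le> \<rho> - tseq k"
proof (rule LIMSEQ_le_const2)
  show "(\<lambda>n. norm (X n - X k)) \<longlonglongrightarrow> norm (xs - X k)"
    by (intro tendsto_intros X_lim)
  have "norm (X n - X k) \<le> \<rho> - tseq k" if "k \<le> n" for n
    using X_diff_le[of k "n - k"] tseq_bounds[of n] that by simp
  then show "\<exists>N. \<forall>n\<ge>N. norm (X n - X k) \<le> \<rho> - tseq k" by blast
qed

lemma xs_in_cball: "xs \<in> cball x0 \<rho>"
  using xs_dist[of 0] by (simp add: dist_norm norm_minus_commute)

text \<open>The Newton equation writes \<open>F (X k)\<close> as \<open>- F' (X k)\<close> applied
  to the step. The operators converge, and the steps tend to 0 with the increments of
  \<open>tseq\<close>. The limit may lie on the boundary of the ball, hence the premise on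
  \<open>D\<close>.\<close>

lemma xs_zero: "F xs = 0" if "xs \<in> D"
proof -
  have "isCont F xs" using F_deriv[OF that] by (rule has_derivative_continuous)
  then have 1: "(\<lambda>k. F (X k)) \<longlonglongrightarrow> F xs" by (rule isCont_tendsto_compose[OF _ X_lim])
  have "isCont F' xs" using F'_cont open_D that by (simp add: continuous_on_eq_continuous_at)
  then have 2: "(\<lambda>k. F' (X k)) \<longlonglongrightarrow> F' xs" by (rule isCont_tendsto_compose[OF _ X_lim])
  have "(\<lambda>k. newton_step F F' (X k) - X k) \<longlonglongrightarrow> 0"
  proof (rule Lim_null_comparison)
    have "(\<lambda>k. tseq (Suc k) - tseq k) \<longlonglongrightarrow> lim tseq - lim tseq"
      using tseq_convergent unfolding convergent_LIMSEQ_iff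
      by (intro tendsto_diff LIMSEQ_Suc)
    then show "(\<lambda>k. tseq (Suc k) - tseq k) \<longlonglongrightarrow> 0" by simp
    show "\<forall>\<^sub>F k in sequentially. norm (newton_step F F' (X k) - X k) \<le> tseq (Suc k) - tseq k"
    proof (intro always_eventually allI)
      fix k show "norm (newton_step F F' (X k) - X k) \<le> tseq (Suc k) - tseq k"
        using newton_step_le[of k] tseq_incr[of k] by linarith
    qed
  qed
  with 2 have "(\<lambda>k. - F' (X k) (newton_step F F' (X k) - X k)) \<longlonglongrightarrow> - F' xs 0"
    by (intro tendsto_intros)
  moreover have "F (X k) = - F' (X k) (newton_step F F' (X k) - X k)" for k
    by (simp add: newton_step_def blinfun.minus_right blinfun_inv_right[OF X_invertible])
  ultimately have "(\<lambda>k. F (X k)) \<longlonglongrightarrow> 0" by simp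
  with 1 show ?thesis by (rule LIMSEQ_unique)
qed

section \<open>Estimates up to the boundary and the error bound\<close>

text \<open>The Lipschitz condition asks for strict inequalities. Shrinking both points towards
  \<open>x0\<close> by a factor \<open>s < 1\<close> secures them, and continuity of
  \<open>F'\<close> carries the bound over as \<open>s\<close> tends to 1.\<close>

lemma radial_limit_bound:
  assumes "x \<in> D" "w \<in> D"
    and "\<And>s. s \<in> {0<..<1} \<Longrightarrow>
      norm (\<Gamma> o\<^sub>L (F' (x0 + s *\<^sub>R (w - x0)) - F' (x0 + s *\<^sub>R (x - x0)))) \<le> B"
  shows "norm (\<Gamma> o\<^sub>L (F' w - F' x)) \<le> B"
proof (rule tendsto_upperbound)
  have *: "((\<lambda>s. F' (x0 + s *\<^sub>R (v - x0))) \<longlongrightarrow> F' v) (at_left (1::real))" if "v \<in> D" for v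
  proof (rule isCont_tendsto_compose[of _ F'])
    show "isCont F' v" using F'_cont open_D that by (simp add: continuous_on_eq_continuous_at)
    have "((\<lambda>s. x0 + s *\<^sub>R (v - x0)) \<longlongrightarrow> x0 + 1 *\<^sub>R (v - x0)) (at_left (1::real))"
      by (intro tendsto_intros)
    then show "((\<lambda>s. x0 + s *\<^sub>R (v - x0)) \<longlongrightarrow> v) (at_left (1::real))" by simp
  qed
  show "((\<lambda>s. norm (\<Gamma> o\<^sub>L (F' (x0 + s *\<^sub>R (w - x0)) - F' (x0 + s *\<^sub>R (x - x0)))))
      \<longlongrightarrow> norm (\<Gamma> o\<^sub>L (F' w - F' x))) (at_left (1::real))"
    by (intro tendsto_intros * assms bounded_bilinear.tendsto[OF bounded_bilinear_blinfun_compose])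
  show "\<forall>\<^sub>F s in at_left (1::real). norm (\<Gamma> o\<^sub>L (F' (x0 + s *\<^sub>R (w - x0)) - F' (x0 + s *\<^sub>R (x - x0)))) \<le> B"
    using assms(3) by (auto simp: eventually_at_left[of 0] intro!: exI[of _ 0])
qed (rule trivial_limit_at_left_real)

lemma lipschitz_closed:
  assumes "x \<in> D" "w \<in> D" "norm (x - x0) + norm (w - x) \<le> \<rho>"
  shows "norm (\<Gamma> o\<^sub>L (F' w - F' x)) \<le> L \<rho> * norm (w - x)"
proof (rule radial_limit_bound[OF assms(1,2)])
  fix s :: real assume s: "s \<in> {0<..<1}"
  let ?a = "s * norm (x - x0)" and ?d = "s * norm (w - x)"
  have "s * (norm (x - x0) + norm (w - x)) \<le> s * \<rho>" using assms s by (intro mult_left_mono) auto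
  moreover have "s * \<rho> < \<rho>" using s \<rho> by simp
  ultimately have ad: "?a + ?d < \<rho>" by (simp add: algebra_simps)
  have d: "0 \<le> ?a" "0 \<le> ?d" using s by auto
  have "x0 + s *\<^sub>R (w - x0) - (x0 + s *\<^sub>R (x - x0)) = s *\<^sub>R (w - x)" by (simp add: algebra_simps)
  then have "norm (\<Gamma> o\<^sub>L (F' (x0 + s *\<^sub>R (w - x0)) - F' (x0 + s *\<^sub>R (x - x0)))) \<le> h' (?a + ?d) - h' ?a"
    using s ad \<rho> by (intro average_lipschitz_majorant'[OF lip]) auto
  also have "\<dots> \<le> L (?a + ?d) * (?a + ?d - ?a)" using ad d \<rho> by (intro majorant'_diff_le) auto
  also have "\<dots> = L (?a + ?d) * ?d" by simp
  also have "\<dots> \<le> L \<rho> * norm (w - x)"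
    using s ad d \<rho> by (intro mult_mono L_le L_nonneg) (auto intro: mult_left_le_one_le)
  finally show "norm (\<Gamma> o\<^sub>L (F' (x0 + s *\<^sub>R (w - x0)) - F' (x0 + s *\<^sub>R (x - x0)))) \<le> L \<rho> * norm (w - x)" .
qed

lemma center_lipschitz_closed:
  assumes "x0 \<in> D" "w \<in> D" "norm (w - x0) \<le> \<rho>"
  shows "norm (\<Gamma> o\<^sub>L (F' w - F' x0)) \<le> 1 + h' \<rho>"
proof (rule radial_limit_bound[OF assms(1,2)])
  fix s :: real assume s: "s \<in> {0<..<1}"
  have "s * norm (w - x0) \<le> s * \<rho>" using assms s by (intro mult_left_mono) auto
  moreover have "s * \<rho> < \<rho>" using s \<rho> by simp
  ultimately have d: "s * norm (w - x0) < \<rho>" by simp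
  have "norm (\<Gamma> o\<^sub>L (F' (x0 + s *\<^sub>R (w - x0)) - F' x0)) \<le> h' (0 + s * norm (w - x0)) - h' 0"
    using s d \<rho> by (intro average_lipschitz_majorant'[OF lip]) auto
  also have "\<dots> \<le> h' \<rho> - h' 0" using s d \<rho> by (intro diff_right_mono majorant'_mono) auto
  finally show "norm (\<Gamma> o\<^sub>L (F' (x0 + s *\<^sub>R (w - x0)) - F' (x0 + s *\<^sub>R (x0 - x0)))) \<le> 1 + h' \<rho>"
    by (simp add: h'_0)
qed

lemma lipschitz_remainder:
  assumes D: "x \<in> D" "p \<in> D" "q \<in> D"
    and p: "norm (x - x0) + norm (p - x) \<le> \<rho>" and q: "norm (x - x0) + norm (q - x) \<le> \<rho>"
  shows "norm (\<Gamma> (F q - F p - F' x (q - p)))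
    \<le> L \<rho> * ((norm (p - x) + norm (q - x)) / 2) * norm (q - p)"
proof -
  define P Q where "P = norm (p - x)" and "Q = norm (q - x)"
  \<comment> \<open>The distance to \<open>x\<close> at parameter \<open>\<tau>\<close> is at most
    \<open>(1 - \<tau>) * P + \<tau> * Q\<close>; this is the antiderivative of the resulting bound,
    and averaging gives \<open>(P + Q) / 2\<close>.\<close>
  define \<phi> where "\<phi> = (\<lambda>\<tau>. L \<rho> * (\<tau> * P + \<tau>\<^sup>2 * ((Q - P) / 2)) * norm (q - p))"
  have L\<rho>: "0 \<le> L \<rho>" using \<rho> by (intro L_nonneg) auto
  have "norm (\<Gamma> (F q - F p - F' x (q - p))) \<le> \<phi> 1 - \<phi> 0"
  proof (rule blinfun_remainder_bound)
    show "(F has_derivative blinfun_apply (F' (p + \<tau> *\<^sub>R (q - p)))) (at (p + \<tau> *\<^sub>R (q - p)))"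
      if "\<tau> \<in> {0..1}" for \<tau>
      using that D by (intro F_deriv segment_in_D)
    show "(\<phi> has_real_derivative L \<rho> * ((1 - \<tau>) * P + \<tau> * Q) * norm (q - p))
        (at \<tau> within {0..1})" if "\<tau> \<in> {0..1}" for \<tau>
      unfolding \<phi>_def by (auto intro!: derivative_eq_intros simp: field_simps)
    fix \<tau> :: real assume \<tau>: "\<tau> \<in> {0<..<1}"
    let ?w = "p + \<tau> *\<^sub>R (q - p)"
    have w: "norm (?w - x) \<le> (1 - \<tau>) * P + \<tau> * Q"
      using segment_dist[of \<tau> p q x] \<tau> by (simp add: P_def Q_def)
    have "(1 - \<tau>) * P + \<tau> * Q \<le> \<rho> - norm (x - x0)"
      using \<tau> p q unfolding P_def Q_def by (intro convex_bound_le) auto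
    with w have "norm (x - x0) + norm (?w - x) \<le> \<rho>" by linarith
    then have "norm (\<Gamma> o\<^sub>L (F' ?w - F' x)) \<le> L \<rho> * norm (?w - x)"
      using \<tau> D by (intro lipschitz_closed segment_in_D) auto
    also have "\<dots> \<le> L \<rho> * ((1 - \<tau>) * P + \<tau> * Q)" using w L\<rho> by (intro mult_left_mono)
    finally show "norm (\<Gamma> o\<^sub>L (F' ?w - F' x)) * norm (q - p)
        \<le> L \<rho> * ((1 - \<tau>) * P + \<tau> * Q) * norm (q - p)"
      by (rule mult_right_mono) simp
  qed
  also have "\<dots> = L \<rho> * ((P + Q) / 2) * norm (q - p)" by (simp add: \<phi>_def field_simps)
  finally show ?thesis by (simp add: P_def Q_def)
qed

lemma cubic_error:
  assumes "h' \<rho> < 0" "xs \<in> D"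
  defines "M \<equiv> L \<rho> / - h' \<rho>"
  shows "norm (xs - X (Suc k)) \<le> M\<^sup>2 / 2 * (1 + M * norm (xs - X k) / 4) * norm (xs - X k) ^ 3"
proof -
  define x t where "x = X k" and "t = tseq k"
  define y e where "y = newton_step F F' x" and "e = norm (xs - x)"
  define K where "K = L \<rho>"
  \<comment> \<open>Thus \<open>norm (x - x0) + e\<close> and
    \<open>norm (x - x0) + norm (y - x)\<close> are at most \<open>\<rho>\<close>, as
    \<open>lipschitz_remainder\<close> demands.\<close>
  have t: "0 \<le> t" "t < \<rho>" "norm (x - x0) \<le> t" and e: "e \<le> \<rho> - t"
    and yx: "norm (y - x) \<le> \<rho> - t"
    using tseq_bounds[of k] X_majorized[of k] xs_dist[of k] newton_step_le[of k]
      half_step_bounds[of "tseq k"]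
    by (auto simp: x_def t_def e_def y_def)
  have D: "x \<in> D" "y \<in> D" using X_in_D newton_step_in_D by (auto simp: x_def y_def)
  have K: "0 \<le> K" unfolding K_def using \<rho> by (intro L_nonneg) auto
  have M: "0 \<le> M" unfolding M_def using K assms(1) by (intro divide_nonneg_pos) (auto simp: K_def)
  \<comment> \<open>Since \<open>h'\<close> increases, \<open>- h' t\<close> may be replaced by the
    smaller \<open>- h' \<rho>\<close>, which does not depend on \<open>k\<close>.\<close>
  have inv: "norm (blinfun_inv (F' x) w) \<le> norm (\<Gamma> w) / - h' \<rho>" for w
  proof -
    have "norm (blinfun_inv (F' x) w) \<le> norm (\<Gamma> w) / - h' t" using t by (intro inverse_bound)
    also have "\<dots> \<le> norm (\<Gamma> w) / - h' \<rho>"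
      using majorant'_mono[of t \<rho>] t \<rho> assms by (intro divide_left_mono) (auto simp: mult_neg_neg)
    finally show ?thesis .
  qed
  note inv_x = X_invertible[of k, folded x_def]
  have bound: "norm (blinfun_inv (F' x) w) \<le> M * c" if "norm (\<Gamma> w) \<le> K * c" for w c
  proof -
    have "norm (\<Gamma> w) / - h' \<rho> \<le> K * c / - h' \<rho>"
      using that assms by (intro divide_right_mono) auto
    with inv[of w] show ?thesis by (simp add: M_def K_def)
  qed
  \<comment> \<open>As \<open>F xs = 0\<close>, the error is the inverse applied to a remainder at
    \<open>x\<close>; with \<open>p = x\<close> the average distance is
    \<open>e / 2\<close>.\<close>
  have "xs - y = - blinfun_inv (F' x) (F xs - F x - F' x (xs - x))"
    using xs_zero[OF assms(2)]
    by (simp add: y_def newton_step_def blinfun.bilinear_simps blinfun_inv_left[OF inv_x])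
  then have "norm (xs - y) = norm (blinfun_inv (F' x) (F xs - F x - F' x (xs - x)))" by simp
  also have "\<dots> \<le> M * (e / 2 * e)"
    using lipschitz_remainder[of x x xs] D assms(2) t e
    by (intro bound) (simp add: K_def e_def)
  finally have y: "norm (xs - y) \<le> M / 2 * e\<^sup>2" by (simp add: power2_eq_square)
  \<comment> \<open>Going through \<open>xs\<close> bounds \<open>y - x\<close> by powers of
    \<open>e\<close>, which leaves only \<open>e\<close> and \<open>M\<close> in the corrector
    error.\<close>
  have yx': "norm (y - x) \<le> M / 2 * e\<^sup>2 + e"
    using norm_triangle_ineq[of "y - xs" "xs - x"] y by (simp add: e_def norm_minus_commute)
  have "xs - corrector x = - blinfun_inv (F' x) (F xs - F y - F' x (xs - y))"
    using xs_zero[OF assms(2)]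
    by (simp add: corrector_def y_def[symmetric] blinfun.bilinear_simps blinfun_inv_left[OF inv_x])
  then have "norm (xs - corrector x) = norm (blinfun_inv (F' x) (F xs - F y - F' x (xs - y)))"
    by simp
  also have "\<dots> \<le> M * ((norm (y - x) + e) / 2 * norm (xs - y))"
    using lipschitz_remainder[of x y xs] D assms(2) t e yx
    by (intro bound) (simp add: K_def e_def mult.assoc)
  also have "\<dots> \<le> M * ((M / 2 * e\<^sup>2 + e + e) / 2 * (M / 2 * e\<^sup>2))"
    using yx' y M by (intro mult_left_mono mult_mono divide_right_mono) (auto simp: e_def)
  also have "\<dots> = M\<^sup>2 / 2 * (1 + M * e / 4) * e ^ 3"
    by (simp add: field_simps power2_eq_square power3_eq_cube)
  finally show ?thesis unfolding X_Suc by (simp add: x_def e_def)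
qed

section \<open>Uniqueness of the zero\<close>

text \<open>For two zeros, \<open>\<Gamma>\<close> maps the remainder taken with
  \<open>F' x0\<close> to their difference up to sign. Hence
  \<open>N \<le> (1 + h' \<rho>) * N\<close> with a factor below 1.\<close>

lemma zero_unique:
  assumes "h' \<rho> < 0" "z \<in> D" "w \<in> D" "norm (z - x0) \<le> \<rho>" "norm (w - x0) \<le> \<rho>" "F z = 0" "F w = 0"
  shows "z = w"
proof -
  have x0: "x0 \<in> D" using ball_subset \<rho> by auto
  define N where "N = norm (z - w)"
  define \<phi> where "\<phi> = (\<lambda>\<tau>. (1 + h' \<rho>) * N * \<tau>)"
  have "norm (\<Gamma> (F z - F w - F' x0 (z - w))) \<le> \<phi> 1 - \<phi> 0"
  proof (rule blinfun_remainder_bound)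
    show "(F has_derivative blinfun_apply (F' (w + \<tau> *\<^sub>R (z - w)))) (at (w + \<tau> *\<^sub>R (z - w)))"
      if "\<tau> \<in> {0..1}" for \<tau>
      using that assms by (intro F_deriv segment_in_D)
    show "(\<phi> has_real_derivative (1 + h' \<rho>) * N) (at \<tau> within {0..1})" if "\<tau> \<in> {0..1}" for \<tau>
      unfolding \<phi>_def by (auto intro!: derivative_eq_intros)
    fix \<tau> :: real assume \<tau>: "\<tau> \<in> {0<..<1}"
    have "(1 - \<tau>) * norm (w - x0) + \<tau> * norm (z - x0) \<le> \<rho>"
      using \<tau> assms by (intro convex_bound_le) auto
    then have "norm (w + \<tau> *\<^sub>R (z - w) - x0) \<le> \<rho>"
      using segment_dist[of \<tau> w z x0] \<tau> by auto
    then have "norm (\<Gamma> o\<^sub>L (F' (w + \<tau> *\<^sub>R (z - w)) - F' x0)) \<le> 1 + h' \<rho>"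
      using \<tau> assms x0 by (intro center_lipschitz_closed segment_in_D) auto
    then show "norm (\<Gamma> o\<^sub>L (F' (w + \<tau> *\<^sub>R (z - w)) - F' x0)) * norm (z - w) \<le> (1 + h' \<rho>) * N"
      unfolding N_def by (rule mult_right_mono) simp
  qed
  then have "N \<le> (1 + h' \<rho>) * N"
    using assms by (simp add: \<phi>_def N_def blinfun.bilinear_simps blinfun_inv_left[OF inv_x0] norm_minus_commute)
  then have "0 \<le> h' \<rho> * N" by (simp add: algebra_simps)
  moreover have "0 \<le> N" by (simp add: N_def)
  ultimately have "N = 0" using assms by (auto simp: zero_le_mult_iff)
  then show ?thesis by (simp add: N_def)
qed

text \<open>With \<open>u = norm (z - x0)\<close>, the image under \<open>\<Gamma>\<close> of the
  remainder at \<open>x0\<close> has norm at least \<open>u - \<beta>\<close> and at most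
  \<open>h u - \<beta> + u\<close>.\<close>

lemma majorant_nonneg_at_zero:
  assumes "r < R" "average_lipschitz D F' L x0 r" "z \<in> D" "norm (z - x0) \<le> r" "F z = 0"
  shows "0 \<le> h (norm (z - x0))"
proof -
  have x0: "x0 \<in> D" using ball_subset \<rho> by auto
  define u where "u = norm (z - x0)"
  \<comment> \<open>The shape matches \<open>h_affine_derivative\<close> with \<open>s = 0\<close>;
    the factor \<open>-1\<close> is \<open>h' 0\<close>.\<close>
  define \<phi> where "\<phi> = (\<lambda>\<tau>. h (0 + \<tau> * (u - 0)) - u * (-1) * \<tau>)"
  have "norm (\<Gamma> (F z - F x0 - F' x0 (z - x0))) \<le> \<phi> 1 - \<phi> 0"
  proof (rule blinfun_remainder_bound)
    show "(F has_derivative blinfun_apply (F' (x0 + \<tau> *\<^sub>R (z - x0)))) (at (x0 + \<tau> *\<^sub>R (z - x0)))"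
      if "\<tau> \<in> {0..1}" for \<tau>
      using that assms x0 by (intro F_deriv segment_in_D)
    show "(\<phi> has_real_derivative (u - 0) * h' (0 + \<tau> * (u - 0)) - u * (-1))
        (at \<tau> within {0..1})" if "\<tau> \<in> {0..1}" for \<tau>
      unfolding \<phi>_def using that assms by (intro h_affine_derivative) (auto simp: u_def)
    fix \<tau> :: real assume \<tau>: "\<tau> \<in> {0<..<1}"
    show "norm (\<Gamma> o\<^sub>L (F' (x0 + \<tau> *\<^sub>R (z - x0)) - F' x0)) * norm (z - x0)
        \<le> (u - 0) * h' (0 + \<tau> * (u - 0)) - u * (-1)"
    proof (cases "u = 0")
      case False
      then have "\<tau> * u < u" using \<tau> by (simp add: u_def)
      then have "\<tau> * u < r" using assms by (simp add: u_def)
      then have "norm (\<Gamma> o\<^sub>L (F' (x0 + \<tau> *\<^sub>R (z - x0)) - F' x0)) \<le> h' (0 + \<tau> * u) - h' 0"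
        using \<tau> assms by (intro average_lipschitz_majorant'[OF assms(2)]) (auto simp: u_def)
      then have "norm (\<Gamma> o\<^sub>L (F' (x0 + \<tau> *\<^sub>R (z - x0)) - F' x0)) * norm (z - x0)
          \<le> (h' (0 + \<tau> * u) - h' 0) * u"
        unfolding u_def by (rule mult_right_mono) simp
      then show ?thesis by (simp add: h'_0 algebra_simps)
    qed (simp add: u_def)
  qed
  moreover have "\<Gamma> (F z - F x0 - F' x0 (z - x0)) = - (z - x0) - \<Gamma> (F x0)"
    using assms by (simp add: blinfun.bilinear_simps blinfun_inv_left[OF inv_x0])
  moreover have "u - \<beta> \<le> norm (- (z - x0) - \<Gamma> (F x0))"
    using norm_triangle_ineq2[of "- (z - x0)" "\<Gamma> (F x0)"]
    by (simp add: u_def \<beta>_def norm_minus_commute)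
  ultimately show ?thesis by (simp add: \<phi>_def h_0 u_def)
qed

end

text \<open>The conclusions are conditioned with a view to the borderline
  \<open>\<beta> = b\<close>, where \<open>ts = r0\<close> and \<open>majorant' L ts = 0\<close>:
  the closed ball may then leave \<open>D\<close>, and \<open>H\<close> is 0 by the convention for
  division by zero. For \<open>\<beta> < b\<close> one has \<open>ts < r0\<close>, and the closed
  ball lies in \<open>D\<close>. Uniqueness assumes the Lipschitz condition on the ball of radius
  \<open>r\<close>.\<close>

theorem theorem3p1:
  fixes D :: "'a::banach set"
    and F :: "'a \<Rightarrow> 'b::banach"
    and F' :: "'a \<Rightarrow> ('a \<Rightarrow>\<^sub>L 'b)"
    and x0 :: 'a
    and L :: "real \<Rightarrow> real"
    and R r0 b \<beta> ts tss H :: real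
  assumes D: "open D" "convex D"
    and F_deriv: "\<And>x. x \<in> D \<Longrightarrow> (F has_derivative blinfun_apply (F' x)) (at x)"
    and F'_cont: "continuous_on D F'"
    and R: "R > 0" "1 / R * integral {0..R} (\<lambda>u. L u * (R - u)) = 1"
    and L_pos: "\<And>u. u \<in> {0..<R} \<Longrightarrow> L u > 0"
    and L_mono: "mono_on {0..<R} L"
    and r0: "r0 \<in> {0..R}" "integral {0..r0} L = 1"
    and b: "b = integral {0..r0} (\<lambda>u. L u * u)"
    and x0: "x0 \<in> D" "blinfun_invertible (F' x0)" "ball x0 r0 \<subseteq> D"
    and \<beta>: "\<beta> = norm (blinfun_inv (F' x0) (F x0))"
    and ts: "ts \<in> {0..r0}" "majorant \<beta> L ts = 0"
    and tss: "tss \<in> {r0..R}" "majorant \<beta> L tss = 0"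
    and lip: "average_lipschitz D F' L x0 ts"
    and \<beta>_pos: "0 < \<beta>" and \<beta>_le: "\<beta> \<le> b"
    and H: "H = L ts / majorant' L ts"
  shows "two_step_newton_well_defined D F F' x0 \<and>
    (\<exists>xs \<in> closure (ball x0 ts).
       two_step_newton F F' x0 \<longlonglongrightarrow> xs \<and>
       (xs \<in> D \<longrightarrow> F xs = 0) \<and>
       (\<beta> < b \<longrightarrow> xs \<in> D \<and> q_superquadratic (two_step_newton F F' x0) xs) \<and>
       (\<forall>r. ts \<le> r \<and> r < tss \<and> average_lipschitz D F' L x0 r \<longrightarrow>
          (\<forall>z \<in> closure (ball x0 r) \<inter> D. F z = 0 \<longrightarrow> z = xs)) \<and>
       (majorant' L ts \<noteq> 0 \<longrightarrow>
          (2 + ts * L ts / majorant' L ts > 0 \<longleftrightarrow>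
             2 - ts * L ts / (1 - integral {0..ts} L) > 0) \<and>
          (2 + ts * L ts / majorant' L ts > 0 \<longrightarrow>
             q_cubic (two_step_newton F F' x0) xs \<and>
             (\<forall>k. norm (xs - two_step_newton F F' x0 (Suc k))
                \<le> 1 / 2 * H ^ 2 * ((2 - ts * H) / (2 + ts * H))
                    * norm (xs - two_step_newton F F' x0 k) ^ 3))))"
proof -
  interpret lipschitz_weight L R
    using L_pos L_mono by unfold_locales
  have int_R: "integral {0..R} (\<lambda>u. L u * (R - u)) = R" using R by (simp add: field_simps)
  have r0_R: "r0 < R" by (rule radius_less[OF R(1) int_R r0])
  have h'_r0: "majorant' L r0 = 0" using r0 by (simp add: majorant'_def)
  have h_r0: "majorant \<beta> L r0 = \<beta> - b"
    using r0 r0_R by (simp add: majorant_eq b mult.commute)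
  have "ts \<noteq> 0" using ts(2) \<beta>_pos by (auto simp: majorant_def)
  then have ts_bounds: "0 < ts" "ts \<le> r0" "ts < R" using ts r0_R by auto
  have h'_ts: "majorant' L ts \<le> 0"
    using majorant'_mono[of ts r0] ts_bounds r0_R h'_r0 by simp
  interpret majorized_newton L R D F F' x0 \<beta> ts
    using D F_deriv F'_cont x0 \<beta> ts lip ts_bounds h'_ts by unfold_locales auto
  have regular: "ts < r0" if "h' ts \<noteq> 0"
    using that ts_bounds h'_r0 by (cases "ts = r0") auto
  have h'_ts_neg: "h' ts < 0" if "ts < r0"
    using majorant'_strict_mono[of ts r0] that ts_bounds r0_R h'_r0 by simp
  have xs_D: "xs \<in> D" if "ts < r0"
    using xs_in_cball that x0(3) by auto
  have closure_eq: "closure (ball x0 r) = cball x0 r" if "ts \<le> r" for r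
    using that ts_bounds by (intro closure_ball) simp
  define M where "M = L ts / - h' ts"
  \<comment> \<open>The factor of \<open>cubic_error\<close> with the error replaced by its uniform
    bound \<open>ts\<close>.\<close>
  define C where "C = M\<^sup>2 / 2 * (1 + M * ts / 4)"
  have M_nonneg: "0 \<le> M"
    unfolding M_def using L_nonneg[of ts] ts_bounds h'_ts by (intro divide_nonneg_nonneg) auto
  have C_nonneg: "0 \<le> C" using M_nonneg ts_bounds by (simp add: C_def)
  have error_le: "norm (xs - X k) \<le> ts" for k
    using xs_dist[of k] tseq_bounds[of k] by simp
  have cubic: "norm (xs - X (Suc k)) \<le> M\<^sup>2 / 2 * (1 + M * norm (xs - X k) / 4) * norm (xs - X k) ^ 3"
    if "ts < r0" for k
    unfolding M_def using h'_ts_neg xs_D that by (intro cubic_error)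
  have cubic_C: "norm (X (Suc k) - xs) \<le> C * norm (X k - xs) ^ 3" if "ts < r0" for k
  proof -
    have "M\<^sup>2 / 2 * (1 + M * norm (xs - X k) / 4) \<le> C"
      unfolding C_def using error_le[of k] M_nonneg
      by (intro mult_left_mono add_left_mono divide_right_mono) auto
    then have "M\<^sup>2 / 2 * (1 + M * norm (xs - X k) / 4) * norm (xs - X k) ^ 3 \<le> C * norm (xs - X k) ^ 3"
      by (rule mult_right_mono) simp
    with cubic[OF that, of k] show ?thesis by (simp only: norm_minus_commute[of xs])
  qed
  have superquadratic: "q_superquadratic X xs" if reg: "ts < r0"
    unfolding q_superquadratic_def
  proof (intro conjI X_lim allI impI)
    fix c :: real assume "0 < c"
    \<comment> \<open>One factor of the cubic bound is absorbed into the constant, because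
      \<open>C\<close> times the error tends to 0.\<close>
    have "(\<lambda>k. C * norm (X k - xs)) \<longlonglongrightarrow> C * norm (xs - xs)"
      by (intro tendsto_intros X_lim)
    then have "\<forall>\<^sub>F k in sequentially. C * norm (X k - xs) < c"
      using \<open>0 < c\<close> by (intro order_tendstoD) auto
    then obtain N where N: "\<And>k. k \<ge> N \<Longrightarrow> C * norm (X k - xs) < c"
      by (auto simp: eventually_sequentially)
    show "\<exists>N. \<forall>k\<ge>N. norm (X (Suc k) - xs) \<le> c * (norm (X k - xs))\<^sup>2"
    proof (intro exI[of _ N] allI impI)
      fix k assume "k \<ge> N"
      have "norm (X (Suc k) - xs) \<le> C * norm (X k - xs) * (norm (X k - xs))\<^sup>2"
        using cubic_C[OF reg, of k] by (simp only: power2_eq_square power3_eq_cube mult.assoc)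
      also have "\<dots> \<le> c * (norm (X k - xs))\<^sup>2"
        using N[OF \<open>k \<ge> N\<close>] by (intro mult_right_mono) auto
      finally show "norm (X (Suc k) - xs) \<le> c * (norm (X k - xs))\<^sup>2" .
    qed
  qed
  have unique: "z = xs" if r: "ts \<le> r" "r < tss" "average_lipschitz D F' L x0 r"
    and z: "z \<in> closure (ball x0 r)" "z \<in> D" "F z = 0" for r z
  proof -
    \<comment> \<open>The normalization of \<open>R\<close> makes \<open>h\<close> positive there,
      so \<open>tss\<close> lies below \<open>R\<close> and the slope estimates apply at
      \<open>tss\<close>.\<close>
    have "majorant \<beta> L R = \<beta>" using int_R by (simp add: majorant_def)
    then have "tss < R" using tss \<beta>_pos by (cases "tss = R") auto
    \<comment> \<open>If \<open>ts = r0\<close>, then \<open>h\<close> and \<open>h'\<close> both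
      vanish at \<open>r0\<close>, and strict convexity leaves no zero \<open>tss > r0\<close>,
      hence no admissible \<open>r\<close>.\<close>
    have reg: "ts < r0"
    proof (rule ccontr)
      assume "\<not> ts < r0"
      then have "ts = r0" using ts_bounds by simp
      then have "h' r0 * (tss - r0) < h tss - h r0"
        using r \<open>tss < R\<close> ts_bounds by (intro majorant_slope_strict) auto
      then show False using h'_r0 tss ts \<open>ts = r0\<close> by simp
    qed
    define u where "u = norm (z - x0)"
    have u: "u \<le> r"
      using z(1) closure_eq[OF r(1)] by (simp add: u_def dist_norm norm_minus_commute)
    have "0 \<le> h u" unfolding u_def
      by (rule majorant_nonneg_at_zero[OF _ r(3) z(2) _ z(3)]) (use u r \<open>tss < R\<close> in \<open>auto simp: u_def\<close>)
    \<comment> \<open>Strictly between \<open>ts\<close> and \<open>tss\<close> the function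
      \<open>h\<close> is negative: it falls up to \<open>r0\<close>, where \<open>h'\<close>
      vanishes, and then rises to 0 at \<open>tss\<close>.\<close>
    have "u \<le> ts"
    proof (rule ccontr)
      assume "\<not> u \<le> ts"
      show False
      proof (cases "u \<le> r0")
        case True
        have "h u - h ts < h' u * (u - ts)"
          using True r0_R \<open>\<not> u \<le> ts\<close> ts_bounds by (intro majorant_slope_strict) auto
        also have "\<dots> \<le> 0"
          using majorant'_mono[of u r0] True r0_R \<open>\<not> u \<le> ts\<close> ts_bounds h'_r0
          by (intro mult_nonpos_nonneg) auto
        finally show False using \<open>0 \<le> h u\<close> ts by simp
      next
        case False
        have "0 \<le> h' u * (tss - u)"
          using majorant'_mono[of r0 u] False u r \<open>tss < R\<close> r0 h'_r0
          by (intro mult_nonneg_nonneg) auto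
        also have "\<dots> < h tss - h u"
          using False u r \<open>tss < R\<close> r0 by (intro majorant_slope_strict) auto
        finally show False using \<open>0 \<le> h u\<close> tss by simp
      qed
    qed
    then show "z = xs"
      using z xs_D[OF reg] xs_zero[OF xs_D[OF reg]] h'_ts_neg[OF reg] xs_in_cball
      by (intro zero_unique) (auto simp: u_def dist_norm norm_minus_commute)
  qed
  have estimate: "norm (xs - X (Suc k))
      \<le> 1 / 2 * H ^ 2 * ((2 - ts * H) / (2 + ts * H)) * norm (xs - X k) ^ 3"
    if reg: "ts < r0" and pos: "2 + ts * H > 0" for k
  proof -
    have HM: "H = - M" by (simp add: H M_def)
    \<comment> \<open>Since \<open>H = - M\<close>, positivity of \<open>2 + ts * H\<close> means
      \<open>a < 2\<close>, and the quotient in the claim is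
      \<open>(2 + a) / (2 - a)\<close>.\<close>
    define a where "a = ts * M"
    have a: "0 \<le> a" "a < 2" using pos M_nonneg ts_bounds by (auto simp: a_def HM)
    have "M * norm (xs - X k) \<le> a"
      using error_le[of k] M_nonneg by (simp add: a_def mult.commute[of ts] mult_left_mono)
    then have "1 + M * norm (xs - X k) / 4 \<le> 1 + a / 4" by simp
    also have "\<dots> \<le> (2 + a) / (2 - a)"
    proof -
      have "(1 + a / 4) * (2 - a) = 2 - a / 2 - a\<^sup>2 / 4" by (simp add: field_simps power2_eq_square)
      also have "\<dots> \<le> 2 + a" using a zero_le_power2[of a] by linarith
      finally show ?thesis using a by (simp add: pos_le_divide_eq)
    qed
    finally have "M\<^sup>2 / 2 * (1 + M * norm (xs - X k) / 4) * norm (xs - X k) ^ 3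
        \<le> M\<^sup>2 / 2 * ((2 + a) / (2 - a)) * norm (xs - X k) ^ 3"
      by (intro mult_right_mono mult_left_mono) auto
    moreover have "1 / 2 * H ^ 2 * ((2 - ts * H) / (2 + ts * H)) = M\<^sup>2 / 2 * ((2 + a) / (2 - a))"
      by (simp add: HM a_def)
    ultimately show ?thesis using order_trans[OF cubic[OF reg, of k]] by (simp only:)
  qed
  have iff: "2 + ts * L ts / h' ts = 2 - ts * L ts / (1 - integral {0..ts} L)"
    unfolding majorant'_def by (metis minus_diff_eq uminus_add_conv_diff divide_minus_right diff_conv_add_uminus)
  have H': "ts * L ts / h' ts = ts * H" by (simp add: H)
  show ?thesis
  proof (intro conjI bexI[of _ xs])
    show "xs \<in> closure (ball x0 ts)" using closure_eq xs_in_cball by simp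
    show "\<beta> < b \<longrightarrow> xs \<in> D \<and> q_superquadratic X xs"
    proof
      assume "\<beta> < b"
      then have "ts < r0" using h_r0 ts ts_bounds by (cases "ts = r0") auto
      then show "xs \<in> D \<and> q_superquadratic X xs" using xs_D superquadratic by blast
    qed
    show "h' ts \<noteq> 0 \<longrightarrow>
      (2 + ts * L ts / h' ts > 0 \<longleftrightarrow> 2 - ts * L ts / (1 - integral {0..ts} L) > 0) \<and>
      (2 + ts * L ts / h' ts > 0 \<longrightarrow> q_cubic X xs \<and>
        (\<forall>k. norm (xs - X (Suc k))
          \<le> 1 / 2 * H ^ 2 * ((2 - ts * H) / (2 + ts * H)) * norm (xs - X k) ^ 3))"
    proof (intro impI conjI allI)
      assume "h' ts \<noteq> 0"
      then have reg: "ts < r0" by (rule regular)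
      show "2 + ts * L ts / h' ts > 0 \<longleftrightarrow> 2 - ts * L ts / (1 - integral {0..ts} L) > 0"
        by (simp only: iff)
      assume pos: "2 + ts * L ts / h' ts > 0"
      show "q_cubic X xs"
        unfolding q_cubic_def using X_lim C_nonneg cubic_C[OF reg] by blast
      show "norm (xs - X (Suc k))
          \<le> 1 / 2 * H ^ 2 * ((2 - ts * H) / (2 + ts * H)) * norm (xs - X k) ^ 3" for k
        using reg pos unfolding H' by (rule estimate)
    qed
  qed (use well_defined X_lim xs_zero unique in auto)
qed

end
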